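(* Let $(\mathbb{W}\subset A\times B,\|\cdot,\cdot\|)$ be a generalized two-normed space, let $k\in B$, and let $[a,b]\subset\mathbb{R}$. For any $g,h\in BV([a,b],\mathbb{W}^k)$ and any scalar $\alpha\in\mathbb{C}$, both $\alpha g$ and $g+h$ are also functions of bounded generalized 2-variation, i.e. $\alpha g\in BV([a,b],\mathbb{W}^k)$ and $g+h\in BV([a,b],\mathbb{W}^k)$.
   Context: Let $A,B$ be complex vector spaces and $\mathbb{W}\subset A\times B$ a non-empty set such that for all $x\in A$, $y\in B$ the sets $\mathbb{W}^{y}=\{u\in A:(u,y)\in\mathbb{W}\}$ and $\mathbb{W}_{x}=\{v\in B:(x,v)\in\mathbb{W}\}$ are vector subspaces of $A$ and $B$ respectively. A generalized two-norm on $\mathbb{W}$ is a map $\|\cdot,\cdot\|\colon\mathbb{W}\to[0,\infty)$ such that: (G1) $\|x,\alpha y\|=|\alpha|\|x,y\|=\|\alpha x,y\|$ for all $\alpha\in\mathbb{C}$, $(x,y)\in\mathbb{W}$; (G2) $\|x,y+z\|\le\|x,y\|+\|x,z\|$ whenever $(x,y),(x,z)\in\mathbb{W}$; (G3) $\|x+y,z\|\le\|x,z\|+\|y,z\|$ whenever $(x,z),(y,z)\in\mathbb{W}$. The pair $(\mathbb{W}\subset A\times B,\|\cdot,\cdot\|)$ is called a generalized two-normed space. $\mathcal{P}([a,b])$ is the set of finite partitions $P=\{a=t_0<t_1<\dots<t_n=b\}$ of the closed interval $[a,b]$. For $k\in B$, $g\colon[a,b]\to\mathbb{W}^k$ and $P\in\mathcal{P}([a,b])$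 put $V_a^b[g,\mathbb{W}^k;P]=\sum_{i=1}^n\|g(t_i)-g(t_{i-1}),k\|$, and $V_a^b(g,\mathbb{W}^k)=\sup\{V_a^b[g,\mathbb{W}^k;P]:P\in\mathcal{P}([a,b])\}$. The function $g$ is of bounded generalized 2-variation if $V_a^b(g,\mathbb{W}^k)<\infty$, and $BV([a,b],\mathbb{W}^k)$ denotes the set of all such functions $g\colon[a,b]\to\mathbb{W}^k$. Sums and scalar multiples of functions are pointwise. *)

theory Defs
  imports "HOL-Analysis.Analysis"
begin

text \<open>
  The complex vector spaces \<open>A\<close> and \<open>B\<close> are the types \<open>'a\<close> and \<open>'b\<close> with scalar multiplications
  \<open>scaleA\<close> and \<open>scaleB\<close>.
\<close>

definition left_section :: "('a \<times> 'b) set \<Rightarrow> 'b \<Rightarrow> 'a set" where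
  "left_section W y = {u. (u, y) \<in> W}"

definition right_section :: "('a \<times> 'b) set \<Rightarrow> 'a \<Rightarrow> 'b set" where
  "right_section W x = {v. (x, v) \<in> W}"

text \<open>
  The two-norm is a total function \<open>N\<close>, of which only the values on \<open>W\<close> are constrained.
\<close>

locale generalized_two_normed_space = vector_space_pair scaleA scaleB
  for scaleA :: "complex \<Rightarrow> 'a::ab_group_add \<Rightarrow> 'a"
    and scaleB :: "complex \<Rightarrow> 'b::ab_group_add \<Rightarrow> 'b" +
  fixes W :: "('a \<times> 'b) set"
    and N :: "'a \<Rightarrow> 'b \<Rightarrow> real"
  assumes W_nonempty: "W \<noteq> {}"
    and subspace_left_section: "\<And>y. vs1.subspace (left_section W y)"
    and subspace_right_section: "\<And>x. vs2.subspace (right_section W x)"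
    and N_nonneg: "\<And>x y. (x, y) \<in> W \<Longrightarrow> 0 \<le> N x y"
    and N_scale_right: "\<And>\<alpha> x y. (x, y) \<in> W \<Longrightarrow> N x (scaleB \<alpha> y) = cmod \<alpha> * N x y"
    and N_scale_left: "\<And>\<alpha> x y. (x, y) \<in> W \<Longrightarrow> N (scaleA \<alpha> x) y = cmod \<alpha> * N x y"
    and N_triangle_right:
      "\<And>x y z. (x, y) \<in> W \<Longrightarrow> (x, z) \<in> W \<Longrightarrow> N x (y + z) \<le> N x y + N x z"
    and N_triangle_left:
      "\<And>x y z. (x, z) \<in> W \<Longrightarrow> (y, z) \<in> W \<Longrightarrow> N (x + y) z \<le> N x z + N y z"

text \<open>
  A partition \<open>a = t\<^sub>0 < \<dots> < t\<^sub>n = b\<close> is the list of its points, of length \<open>n + 1\<close>; the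
  case \<open>n = 0\<close> occurs only for \<open>a = b\<close>.
\<close>

definition interval_partitions :: "real \<Rightarrow> real \<Rightarrow> real list set" where
  "interval_partitions a b =
     {t. t \<noteq> [] \<and> sorted_wrt (<) t \<and> hd t = a \<and> last t = b}"

definition two_variation_on ::
  "('a::ab_group_add \<Rightarrow> 'b \<Rightarrow> real) \<Rightarrow> 'b \<Rightarrow> (real \<Rightarrow> 'a) \<Rightarrow> real list \<Rightarrow> real" where
  "two_variation_on N k g t = (\<Sum>i = 1..length t - 1. N (g (t ! i) - g (t ! (i - 1))) k)"

definition two_variation ::
  "('a::ab_group_add \<Rightarrow> 'b \<Rightarrow> real) \<Rightarrow> 'b \<Rightarrow> real \<Rightarrow> real \<Rightarrow> (real \<Rightarrow> 'a) \<Rightarrow> ereal" where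
  "two_variation N k a b g = (SUP t \<in> interval_partitions a b. ereal (two_variation_on N k g t))"

text \<open>
  A function on \<open>[a, b]\<close> is represented by any function on \<open>\<real>\<close> extending it; the values
  outside \<open>[a, b]\<close> are irrelevant.
\<close>

definition BV ::
  "('a::ab_group_add \<times> 'b) set \<Rightarrow> ('a \<Rightarrow> 'b \<Rightarrow> real) \<Rightarrow> 'b \<Rightarrow> real \<Rightarrow> real \<Rightarrow> (real \<Rightarrow> 'a) set" where
  "BV W N k a b = {g. g \<in> {a..b} \<rightarrow> left_section W k \<and> two_variation N k a b g < \<infinity>}"

end

theory Submission
  imports Defs
begin

text \<open>On a fixed partition the variation sum is homogeneous and subadditive in the function,
  because each increment of \<alpha> g or g + h is the scaled or summed increment and the two-norm
  is homogeneous and subadditive in its first argument (\<open>two_variation_on_scale\<close>,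
  \<open>two_variation_on_add_le\<close>). So bounds C and D for g and h, uniform over all
  partitions, give the bounds |\<alpha>| C and C + D. The section of \<open>W\<close> at
  \<open>k\<close> is a subspace, so the new functions still take values in it.\<close>

text \<open>Functions are controlled only on [a, b], so their values at partition points can be used
  only once these points are known to lie there.\<close>

lemma interval_partitions_nth_in:
  assumes "t \<in> interval_partitions a b" and "i < length t"
  shows "t ! i \<in> {a..b}"
proof -
  have t: "t \<noteq> []" "sorted t" "hd t = a" "last t = b"
    using assms(1) by (auto simp: interval_partitions_def strict_sorted_imp_sorted)
  have "t ! 0 \<le> t ! i" "t ! i \<le> t ! (length t - 1)"
    using t(2) assms(2) by (auto intro!: sorted_nth_mono)
  then show ?thesis
    using t by (simp add: hd_conv_nth last_conv_nth)
qed

text \<open>Trades the extended-real supremum for a real bound C common to all partitions, so that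
  the later estimates stay in the reals.\<close>

lemma two_variation_less_infinity_iff:
  "two_variation N k a b g < \<infinity> \<longleftrightarrow>
    (\<exists>C. \<forall>t \<in> interval_partitions a b. two_variation_on N k g t \<le> C)"
proof
  assume "two_variation N k a b g < \<infinity>"
  \<comment> \<open>Density of the reals in \<open>ereal\<close> puts a real C strictly between the
    supremum and infinity.\<close>
  then obtain C where "two_variation N k a b g < ereal C"
    using ereal_dense2 by blast
  then have "two_variation_on N k g t \<le> C" if "t \<in> interval_partitions a b" for t
    using SUP_upper[OF that, of "\<lambda>t. ereal (two_variation_on N k g t)"]
    unfolding two_variation_def by (metis ereal_less_eq(3) le_less_trans less_imp_le)
  then show "\<exists>C. \<forall>t \<in> interval_partitions a b. two_variation_on N k g t \<le> C"
    by blast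
next
  assume "\<exists>C. \<forall>t \<in> interval_partitions a b. two_variation_on N k g t \<le> C"
  then obtain C where "\<forall>t \<in> interval_partitions a b. two_variation_on N k g t \<le> C"
    by blast
  then have "two_variation N k a b g \<le> ereal C"
    unfolding two_variation_def by (intro SUP_least) simp
  then show "two_variation N k a b g < \<infinity>"
    by (rule le_less_trans) simp
qed

lemma BV_iff_bounded:
  "g \<in> BV W N k a b \<longleftrightarrow> g \<in> {a..b} \<rightarrow> left_section W k \<and>
    (\<exists>C. \<forall>t \<in> interval_partitions a b. two_variation_on N k g t \<le> C)"
  unfolding BV_def mem_Collect_eq two_variation_less_infinity_iff ..

context generalized_two_normed_space
begin

text \<open>Equality holds term by term, by homogeneity of \<open>N\<close> in its first
  argument.\<close>

lemma two_variation_on_scale: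
  assumes "g \<in> {a..b} \<rightarrow> left_section W k" and "t \<in> interval_partitions a b"
  shows "two_variation_on N k (\<lambda>s. scaleA \<alpha> (g s)) t = cmod \<alpha> * two_variation_on N k g t"
  unfolding two_variation_on_def sum_distrib_left
proof (rule sum.cong)
  fix i assume "i \<in> {1..length t - 1}"
  then have "g (t ! i) \<in> left_section W k" "g (t ! (i - 1)) \<in> left_section W k"
    by (auto intro!: funcset_mem[OF assms(1)] interval_partitions_nth_in[OF assms(2)])
  \<comment> \<open>The axioms for \<open>N\<close> apply only on \<open>W\<close>; the increment
    lies there because the section at \<open>k\<close> is closed under differences.\<close>
  then have "(g (t ! i) - g (t ! (i - 1)), k) \<in> W"
    using vs1.subspace_diff[OF subspace_left_section] by (auto simp: left_section_def)
  then show "N (scaleA \<alpha> (g (t ! i)) - scaleA \<alpha> (g (t ! (i - 1)))) k =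
      cmod \<alpha> * N (g (t ! i) - g (t ! (i - 1))) k"
    using N_scale_left by (simp flip: vs1.scale_right_diff_distrib)
qed simp

text \<open>After regrouping, each increment of the sum is the sum of the two increments, and the
  triangle inequality in the first argument applies term by term.\<close>

lemma two_variation_on_add_le:
  assumes "g \<in> {a..b} \<rightarrow> left_section W k" and "h \<in> {a..b} \<rightarrow> left_section W k"
    and "t \<in> interval_partitions a b"
  shows "two_variation_on N k (\<lambda>s. g s + h s) t \<le>
    two_variation_on N k g t + two_variation_on N k h t"
  unfolding two_variation_on_def sum.distrib[symmetric]
proof (rule sum_mono)
  fix i assume i: "i \<in> {1..length t - 1}"
  have diff: "(f (t ! i) - f (t ! (i - 1)), k) \<in> W" if "f \<in> {a..b} \<rightarrow> left_section W k" for f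
  proof -
    have "f (t ! i) \<in> left_section W k" "f (t ! (i - 1)) \<in> left_section W k"
      using i by (auto intro!: funcset_mem[OF that] interval_partitions_nth_in[OF assms(3)])
    then show ?thesis
      using vs1.subspace_diff[OF subspace_left_section] by (auto simp: left_section_def)
  qed
  show "N (g (t ! i) + h (t ! i) - (g (t ! (i - 1)) + h (t ! (i - 1)))) k \<le>
      N (g (t ! i) - g (t ! (i - 1))) k + N (h (t ! i) - h (t ! (i - 1))) k"
    using N_triangle_left[OF diff[OF assms(1)] diff[OF assms(2)]] by (simp add: add_diff_add)
qed

lemma BV_scale:
  assumes "g \<in> BV W N k a b"
  shows "(\<lambda>t. scaleA \<alpha> (g t)) \<in> BV W N k a b"
proof -
  have g: "g \<in> {a..b} \<rightarrow> left_section W k"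
    using assms by (simp add: BV_iff_bounded)
  obtain C where "\<forall>t \<in> interval_partitions a b. two_variation_on N k g t \<le> C"
    using assms by (auto simp: BV_iff_bounded)
  then have "\<forall>t \<in> interval_partitions a b.
      two_variation_on N k (\<lambda>s. scaleA \<alpha> (g s)) t \<le> cmod \<alpha> * C"
    by (simp add: two_variation_on_scale[OF g] mult_left_mono)
  then show ?thesis
    \<comment> \<open>The bound settles finiteness; closure of the section under scaling keeps the
      values in it.\<close>
    using g vs1.subspace_scale[OF subspace_left_section]
    by (auto simp: BV_iff_bounded Pi_iff)
qed

lemma BV_add:
  assumes "g \<in> BV W N k a b" and "h \<in> BV W N k a b"
  shows "(\<lambda>t. g t + h t) \<in> BV W N k a b"
proof -
  have gh: "g \<in> {a..b} \<rightarrow> left_section W k" "h \<in> {a..b} \<rightarrow> left_section W k"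
    using assms by (simp_all add: BV_iff_bounded)
  obtain C D where "\<forall>t \<in> interval_partitions a b. two_variation_on N k g t \<le> C"
    and "\<forall>t \<in> interval_partitions a b. two_variation_on N k h t \<le> D"
    using assms by (auto simp: BV_iff_bounded)
  then have "\<forall>t \<in> interval_partitions a b.
      two_variation_on N k (\<lambda>s. g s + h s) t \<le> C + D"
    \<comment> \<open>C and D do not depend on the partition, so neither does C + D.\<close>
    using two_variation_on_add_le[OF gh] by fastforce
  then show ?thesis
    using gh vs1.subspace_add[OF subspace_left_section]
    by (auto simp: BV_iff_bounded Pi_iff)
qed

end

theorem theorem4p12:
  fixes scaleA :: "complex \<Rightarrow> 'a::ab_group_add \<Rightarrow> 'a"
    and scaleB :: "complex \<Rightarrow> 'b::ab_group_add \<Rightarrow> 'b"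
    and W :: "('a \<times> 'b) set"
    and N :: "'a \<Rightarrow> 'b \<Rightarrow> real"
    and k :: 'b
    and a b :: real
    and g h :: "real \<Rightarrow> 'a"
    and \<alpha> :: complex
  assumes "generalized_two_normed_space scaleA scaleB W N"
    and "a \<le> b"
    and "g \<in> BV W N k a b"
    and "h \<in> BV W N k a b"
  shows "(\<lambda>t. scaleA \<alpha> (g t)) \<in> BV W N k a b \<and> (\<lambda>t. g t + h t) \<in> BV W N k a b"
  using generalized_two_normed_space.BV_scale[OF assms(1,3)]
    generalized_two_normed_space.BV_add[OF assms(1,3,4)]
  by blast

end
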